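(* Let $d\geq 2$ be a fixed integer. There is a constant $\kappa$ depending only on $d$ such that the following holds. Let $P=\{p_1,\ldots,p_n\}$ be a point set in $\mathbb{R}^d$ and let $D$ be a distance matrix for $P$ such that $|p_ip_j|<|p_kp_\ell|$ if and only if $D[i,j]<D[k,\ell]$. Let $T$ be a tour on $P$ that is optimal for the distances given by $D$. Then the set of edges of $T$ (viewed as straight-line segments in $\mathbb{R}^d$) has the Packing Property with constant $\kappa$.
   Context: Here $|p_ip_j|$ is the Euclidean distance, and $D$ is an $n\times n$ real matrix (its entries need not satisfy the triangle inequality). A tour on $P$ is a cycle visiting every point of $P$ exactly once; it is optimal for $D$ if the sum of $D[i,j]$ over its edges $p_ip_j$ is minimum among all tours on $P$. For an axis-parallel hypercube (of positive side length) with boundary $\sigma$, $\mathrm{size}(\sigma)$ is its side length, $\sigma_{\mathrm{in}}$ is the set of points inside or on $\sigma$, and $\sigma_{\mathrm{out}}$ the set of points strictly outside $\sigma$. A segment crosses $\sigma$ if one of its endpoints lies in $\sigma_{\mathrm{in}}$ and the other in $\sigma_{\mathrm{out}}$. A set $S$ of segments in $\mathbb{R}^d$ has the Packing Property with constant $\kappa$ if for every axis-parallel hypercube, with boundary $\sigma$, both of the following hold: (PP1) $|\{s\in S \mid s \text{ crosses } \sigma \text{ and } \mathrm{length}(s)\geq \mathrm{size}(\sigma)\}|\leq\kappa$; (PP2) $|\{s\in S \mid s\subset\sigma_{\mathrm{in}} \text{ and } \mathrm{length}(s)\geq \mathrm{size}(\sigma)/4\}|\leq\kappa$, where $\mathrm{length}(s)$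 is the Euclidean length of $s$. *)

theory Defs
  imports "HOL-Analysis.Analysis" "HOL-Combinatorics.Multiset_Permutations"
begin

text \<open>A segment is the set of its points. By \<open>segment_length_closed_segment\<close> the
  description below is well defined, because a segment determines its endpoints.\<close>

definition segment_length :: "(real ^ 'd) set \<Rightarrow> real" where
  "segment_length s = (THE l. \<exists>a b. s = closed_segment a b \<and> l = dist a b)"

lemma segment_length_closed_segment: "segment_length (closed_segment a b) = dist a b"
  unfolding segment_length_def
proof (rule the_equality)
  show "\<exists>a' b'. closed_segment a b = closed_segment a' b' \<and> dist a b = dist a' b'"
    by blast
next
  fix l
  assume "\<exists>a' b'. closed_segment a b = closed_segment a' b' \<and> l = dist a' b'"
  then obtain a' b' where "{a, b} = {a', b'}" "l = dist a' b'"
    by auto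
  then show "l = dist a b"
    by (auto simp: doubleton_eq_iff dist_commute)
qed

text \<open>The hypercube with least corner \<open>c\<close> and side length \<open>r\<close>. Being closed, it is the set
  of points inside or on its boundary; its complement is the set of points strictly outside.\<close>

definition hypercube :: "real ^ 'd \<Rightarrow> real \<Rightarrow> (real ^ 'd) set" where
  "hypercube c r = cbox c (\<chi> i. c $ i + r)"

definition crosses :: "(real ^ 'd) set \<Rightarrow> (real ^ 'd) set \<Rightarrow> bool" where
  "crosses s Q \<longleftrightarrow> (\<exists>a b. s = closed_segment a b \<and> a \<in> Q \<and> b \<in> - Q)"

text \<open>Finiteness is explicit because \<^const>\<open>card\<close> is \<open>0\<close> on infinite sets.\<close>

definition packing_property :: "nat \<Rightarrow> (real ^ 'd) set set \<Rightarrow> bool" where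
  "packing_property \<kappa> S \<longleftrightarrow>
    (\<forall>c r. r > 0 \<longrightarrow>
      (let long = {s \<in> S. crosses s (hypercube c r) \<and> segment_length s \<ge> r};
           inner = {s \<in> S. s \<subseteq> hypercube c r \<and> segment_length s \<ge> r / 4}
       in finite long \<and> card long \<le> \<kappa> \<and> finite inner \<and> card inner \<le> \<kappa>))"

text \<open>A tour on \<open>n\<close> points is given by listing the indices \<open>1, \<dots>, n\<close> in the cyclic order in
  which they are visited; the last index is joined to the first one. For \<open>n = 2\<close> this is the
  closed walk along the single edge and back, and for \<open>n = 1\<close> a degenerate loop.\<close>

definition tours :: "nat \<Rightarrow> nat list set" where
  "tours n = permutations_of_set {1..n}"

definition tour_edges :: "nat list \<Rightarrow> (nat \<times> nat) list" where
  "tour_edges t = zip t (rotate1 t)"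

definition tour_cost :: "(nat \<Rightarrow> nat \<Rightarrow> real) \<Rightarrow> nat list \<Rightarrow> real" where
  "tour_cost D t = (\<Sum>(i, j)\<leftarrow>tour_edges t. D i j)"

definition optimal_tour :: "nat \<Rightarrow> (nat \<Rightarrow> nat \<Rightarrow> real) \<Rightarrow> nat list \<Rightarrow> bool" where
  "optimal_tour n D t \<longleftrightarrow> t \<in> tours n \<and> (\<forall>t' \<in> tours n. tour_cost D t \<le> tour_cost D t')"

definition tour_segments :: "(nat \<Rightarrow> real ^ 'd) \<Rightarrow> nat list \<Rightarrow> (real ^ 'd) set set" where
  "tour_segments p t = (\<lambda>(i, j). closed_segment (p i) (p j)) ` set (tour_edges t)"

definition rank_compatible :: "nat \<Rightarrow> (nat \<Rightarrow> real ^ 'd) \<Rightarrow> (nat \<Rightarrow> nat \<Rightarrow> real) \<Rightarrow> bool" where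
  "rank_compatible n p D \<longleftrightarrow>
    (\<forall>i \<in> {1..n}. \<forall>j \<in> {1..n}. \<forall>k \<in> {1..n}. \<forall>l \<in> {1..n}.
      dist (p i) (p j) < dist (p k) (p l) \<longleftrightarrow> D i j < D k l)"

end

theory Submission
  imports Defs
begin

text \<open>If two edges of the tour, traversed in the same direction, both start (or both end) in a
  cube of side \<open>r\<close>, have length at least \<open>r / 4\<close>, nearly agree in that endpoint (up to a small
  multiple of \<open>r\<close>) and nearly agree in direction, then exchanging them by a 2-opt move replaces
  each edge by a shorter one. This lowers the cost for every matrix that orders the pairs as the
  Euclidean distance does. By compactness of the cube times the unit sphere, only boundedly many
  edges avoid such coincidences. Both halves of the packing property are instances, since the
  edges counted there have an endpoint in the cube and length at least \<open>r / 4\<close>.\<close>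

section \<open>The 2-opt move\<close>

text \<open>Unlike \<open>tour_cost\<close>, this has no closing edge, so the cost splits at every
  cut of the list.\<close>

definition walk_cost :: "('a \<Rightarrow> 'a \<Rightarrow> real) \<Rightarrow> 'a list \<Rightarrow> real" where
  "walk_cost D w = (\<Sum>(i, j)\<leftarrow>zip w (tl w). D i j)"

lemma walk_cost_append:
  assumes "xs \<noteq> []" "ys \<noteq> []"
  shows "walk_cost D (xs @ ys) = walk_cost D xs + D (last xs) (hd ys) + walk_cost D ys"
  using assms
proof (induction xs)
  case (Cons x xs)
  show ?case
  proof (cases xs)
    case Nil
    then show ?thesis
      using Cons.prems by (cases ys) (auto simp: walk_cost_def)
  next
    case (Cons y zs)
    then show ?thesis
      using Cons.IH Cons.prems by (simp add: walk_cost_def)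
  qed
qed simp

lemma walk_cost_rev:
  assumes "\<And>i j. i \<in> set w \<Longrightarrow> j \<in> set w \<Longrightarrow> D i j = D j i"
  shows "walk_cost D (rev w) = walk_cost D w"
  using assms
proof (induction w)
  case (Cons x w)
  show ?case
  proof (cases "w = []")
    case False
    then have "walk_cost D (rev (x # w)) = walk_cost D w + D (hd w) x + walk_cost D [x]"
      using Cons by (simp add: walk_cost_append last_rev)
    also have "D (hd w) x = D x (hd w)"
      using Cons.prems False by simp
    also have "walk_cost D w + D x (hd w) + walk_cost D [x] = walk_cost D ([x] @ w)"
      using False by (subst walk_cost_append) auto
    finally show ?thesis
      by simp
  qed simp
qed simp

text \<open>Repeating the first vertex at the end turns the closing edge into an ordinary
  one.\<close>

lemma tour_cost_eq_walk_cost: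
  assumes "t \<noteq> []"
  shows "tour_cost D t = walk_cost D (t @ [hd t])"
proof -
  obtain x r where t: "t = x # r"
    using assms by (cases t) auto
  \<comment> \<open>\<open>zip\<close> stops at the shorter list, so the extra \<open>x\<close>
    contributes no pair.\<close>
  have "zip (x # r) (r @ [x]) = zip ((x # r) @ [x]) (r @ [x])"
    by (subst zip_append1) simp
  then show ?thesis
    by (simp add: t tour_cost_def tour_edges_def walk_cost_def)
qed

text \<open>By symmetry the reversed block keeps its inner cost, so only the two edges joining it to
  the rest change. The vertex \<open>l\<close> after the block wraps around to the head of
  \<open>xs\<close> when \<open>zs\<close> is empty.\<close>

lemma tour_cost_rev_middle:
  fixes xs ys zs :: "nat list"
  assumes "xs \<noteq> []" "ys \<noteq> []"
    and sym: "\<And>i j. i \<in> set ys \<Longrightarrow> j \<in> set ys \<Longrightarrow> D i j = D j i"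
  defines "l \<equiv> hd (zs @ [hd xs])"
  shows "tour_cost D (xs @ rev ys @ zs) + D (last xs) (hd ys) + D (last ys) l =
    tour_cost D (xs @ ys @ zs) + D (last xs) (last ys) + D (hd ys) l"
proof -
  have "tour_cost D (xs @ us @ zs) = walk_cost D xs + D (last xs) (hd us) + walk_cost D us
      + D (last us) l + walk_cost D (zs @ [hd xs])" if "us \<noteq> []" for us
    using that assms(1)
    by (simp add: tour_cost_eq_walk_cost walk_cost_append l_def)
  from this[of ys] this[of "rev ys"] show ?thesis
    using assms(2) walk_cost_rev[of ys D] sym by (simp add: hd_rev last_rev)
qed

text \<open>The competing tour reverses the block at positions \<open>m + 1\<close> to
  \<open>m'\<close>. \<open>rotate1 t\<close> lists the cyclic successors, so the last position
  needs no separate formula.\<close>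

lemma optimal_tour_two_opt_positions:
  assumes opt: "optimal_tour n D t"
    and sym: "\<And>i j. i \<in> {1..n} \<Longrightarrow> j \<in> {1..n} \<Longrightarrow> D i j = D j i"
    and m: "m < m'" "m' < length t"
  shows "D (t ! m) (rotate1 t ! m) + D (t ! m') (rotate1 t ! m')
    \<le> D (t ! m) (t ! m') + D (rotate1 t ! m) (rotate1 t ! m')"
proof -
  have t: "set t = {1..n}" "distinct t"
    using opt by (auto simp: optimal_tour_def tours_def permutations_of_set_def)
  define xs where "xs = take (Suc m) t"
  define ys where "ys = drop (Suc m) (take (Suc m') t)"
  define zs where "zs = drop (Suc m') t"
  have "xs = take (Suc m) (take (Suc m') t)"
    using m by (simp add: xs_def min_def)
  then have "xs @ ys = take (Suc m') t"
    unfolding ys_def by (metis append_take_drop_id)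
  then have split: "t = xs @ ys @ zs"
    unfolding zs_def by (metis append_assoc append_take_drop_id)
  have ne: "xs \<noteq> []" "ys \<noteq> []"
    using m by (auto simp: xs_def ys_def)
  have "last xs = t ! m"
    using m by (simp add: xs_def take_Suc_conv_app_nth)
  moreover have "hd xs = t ! 0"
    using m by (cases t) (auto simp: xs_def)
  ultimately have xs: "last xs = t ! m" "hd xs = t ! 0" .
  have ys: "hd ys = t ! Suc m" "last ys = t ! m'"
    using m ne by (auto simp: ys_def hd_drop_conv_nth last_conv_nth)
  have r: "rotate1 t ! m = t ! Suc m"
    using m by (simp add: nth_rotate1)
  have l: "hd (zs @ [hd xs]) = rotate1 t ! m'"
  proof (cases "Suc m' = length t")
    case True
    then show ?thesis
      using m xs by (simp add: zs_def nth_rotate1)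
  next
    case False
    then have "Suc m' < length t"
      using m by simp
    then show ?thesis
      using m by (simp add: zs_def nth_rotate1 hd_append hd_drop_conv_nth)
  qed
  have "xs @ rev ys @ zs \<in> tours n"
    using t unfolding split by (auto simp: tours_def permutations_of_set_def)
  then have "tour_cost D (xs @ ys @ zs) \<le> tour_cost D (xs @ rev ys @ zs)"
    using opt split by (auto simp: optimal_tour_def)
  moreover have "D i j = D j i" if "i \<in> set ys" "j \<in> set ys" for i j
    using that t(1) unfolding split by (intro sym) auto
  ultimately show ?thesis
    using tour_cost_rev_middle[where xs = xs and ys = ys and zs = zs and D = D] ne
    by (simp add: xs(1) ys r l)
qed

lemma tour_edges_range:
  assumes "t \<in> tours n" "(i, j) \<in> set (tour_edges t)"
  shows "i \<in> {1..n}" "j \<in> {1..n}"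
  using assms set_zip_leftD[of i j t "rotate1 t"] set_zip_rightD[of i j t "rotate1 t"]
  by (auto simp: tours_def permutations_of_set_def tour_edges_def)

lemma optimal_tour_two_opt:
  assumes opt: "optimal_tour n D t"
    and sym: "\<And>i j. i \<in> {1..n} \<Longrightarrow> j \<in> {1..n} \<Longrightarrow> D i j = D j i"
    and e: "(i, j) \<in> set (tour_edges t)" "(k, l) \<in> set (tour_edges t)" "(i, j) \<noteq> (k, l)"
  shows "D i j + D k l \<le> D i k + D j l"
proof -
  obtain m m' where m: "m < length t" "i = t ! m" "j = rotate1 t ! m"
    and m': "m' < length t" "k = t ! m'" "l = rotate1 t ! m'"
    using e(1,2) by (auto simp: tour_edges_def set_zip)
  have "t \<in> tours n"
    using opt by (simp add: optimal_tour_def)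
  \<comment> \<open>Symmetry handles the case where the second edge comes first in the list.\<close>
  then have "D i k = D k i" "D j l = D l j"
    using sym tour_edges_range e(1,2) by blast+
  moreover have "m \<noteq> m'"
    using e(3) m m' by auto
  ultimately show ?thesis
    using optimal_tour_two_opt_positions[OF opt sym, of m m']
      optimal_tour_two_opt_positions[OF opt sym, of m' m] m m'
    by (cases "m < m'") auto
qed

section \<open>Nearly parallel edges\<close>

text \<open>With \<open>u\<close> and \<open>v\<close> the lengths of the two edges,
  \<open>b' - b\<close> consists of a shift by \<open>a' - a\<close>, a lengthening by
  \<open>v - u\<close> and a turn of size below \<open>u / 6\<close>. As \<open>r\<close> is at most
  \<open>4 * u\<close>, the total is less than \<open>v - u / 6\<close>.\<close>

lemma dist_less_if_nearly_parallel:
  fixes a b a' b' :: "'a :: real_normed_vector"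
  assumes "dist a a' < r / 6" "r / 4 \<le> dist a b" "dist a b \<le> dist a' b'"
    and "dist (sgn (b - a)) (sgn (b' - a')) < 1 / 6"
  shows "dist b b' < dist a' b'"
proof -
  define u v where "u = norm (b - a)" and "v = norm (b' - a')"
  have uv: "dist a b = u" "dist a' b' = v"
    by (simp_all add: u_def v_def dist_norm norm_minus_commute)
  have "0 < r"
    using assms(1) zero_le_dist[of a a'] by linarith
  then have "0 < u" "u \<le> v" "0 < v"
    using assms uv by auto
  have "b - a = u *\<^sub>R sgn (b - a)" "b' - a' = v *\<^sub>R sgn (b' - a')"
    using \<open>0 < u\<close> \<open>0 < v\<close> by (auto simp: u_def v_def sgn_div_norm)
  then have "b' - b = (a' - a) + (v - u) *\<^sub>R sgn (b' - a')
      + u *\<^sub>R (sgn (b' - a') - sgn (b - a))"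
    by (simp add: algebra_simps)
  also have "norm \<dots> \<le> norm (a' - a) + norm ((v - u) *\<^sub>R sgn (b' - a'))
      + norm (u *\<^sub>R (sgn (b' - a') - sgn (b - a)))"
    by (intro norm_triangle_mono norm_triangle_ineq order_refl)
  also have "\<dots> \<le> norm (a' - a) + (v - u) + u * dist (sgn (b - a)) (sgn (b' - a'))"
    using \<open>0 < u\<close> \<open>u \<le> v\<close> by (simp add: norm_sgn dist_norm norm_minus_commute)
  also have "\<dots> < r / 6 + (v - u) + u * (1 / 6)"
    using assms(1,4) \<open>0 < u\<close>
    by (intro add_less_le_mono add_strict_right_mono mult_left_mono)
      (auto simp: dist_norm norm_minus_commute)
  also have "\<dots> \<le> v"
    using assms(2) uv \<open>0 < r\<close> by simp
  finally show ?thesis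
    unfolding uv(2) by (simp add: dist_norm norm_minus_commute)
qed

text \<open>The two new distances are matched with the two old ones instead of comparing sums, since
  a rank-compatible matrix preserves only the order of distances.\<close>

definition two_opt_improves :: "'a :: metric_space \<Rightarrow> 'a \<Rightarrow> 'a \<Rightarrow> 'a \<Rightarrow> bool" where
  "two_opt_improves a b a' b' \<longleftrightarrow>
    dist a a' < dist a b \<and> dist b b' < dist a' b' \<or>
    dist a a' < dist a' b' \<and> dist b b' < dist a b"

text \<open>Reversing both edges lets those that end in the cube be counted like those that start
  there.\<close>

lemma two_opt_improves_swap: "two_opt_improves b a b' a' \<longleftrightarrow> two_opt_improves a b a' b'"
  by (auto simp: two_opt_improves_def dist_commute)

text \<open>The gap between the starts is below \<open>r / 4\<close>, so it is matched with the
  shorter edge; the gap between the ends is matched with the longer one.\<close>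

lemma two_opt_improves_if_nearly_parallel:
  fixes a b a' b' :: "'a :: real_normed_vector"
  assumes "dist a a' < r / 6" "r / 4 \<le> dist a b" "r / 4 \<le> dist a' b'"
    and "dist (sgn (b - a)) (sgn (b' - a')) < 1 / 6"
  shows "two_opt_improves a b a' b'"
proof -
  have "dist a a' < r / 4"
    using assms(1) zero_le_dist[of a a'] by linarith
  then have "dist a a' < dist a b" "dist a a' < dist a' b'"
    using assms by auto
  then show ?thesis
    using assms dist_less_if_nearly_parallel[of a a' r b b']
      dist_less_if_nearly_parallel[of a' a r b' b]
    by (cases "dist a b \<le> dist a' b'") (auto simp: two_opt_improves_def dist_commute)
qed

section \<open>Counting\<close>

text \<open>Finitely many balls of radius \<open>e / 2\<close> cover \<open>K\<close>, and each
  contains \<open>f x\<close> for at most one \<open>x\<close>. Their number depends on neither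
  \<open>A\<close> nor \<open>f\<close>.\<close>

lemma compact_separated_family_bounded:
  fixes K :: "'a :: metric_space set"
  assumes "compact K" "e > 0"
  shows "\<exists>N. \<forall>(A :: 'b set) f. f ` A \<subseteq> K \<longrightarrow>
    (\<forall>x\<in>A. \<forall>y\<in>A. dist (f x) (f y) < e \<longrightarrow> x = y) \<longrightarrow> card A \<le> N"
proof -
  from assms obtain C where C: "finite C" "K \<subseteq> (\<Union>x\<in>C. ball x (e / 2))"
    unfolding compact_eq_totally_bounded by (meson half_gt_zero)
  show ?thesis
  proof (intro exI allI impI)
    fix A :: "'b set" and f
    assume f: "f ` A \<subseteq> K" and sep: "\<forall>x\<in>A. \<forall>y\<in>A. dist (f x) (f y) < e \<longrightarrow> x = y"
    have "\<forall>x\<in>A. \<exists>z\<in>C. dist z (f x) < e / 2"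
      using f C(2) by (force simp: subset_eq)
    then obtain g where g: "\<And>x. x \<in> A \<Longrightarrow> g x \<in> C \<and> dist (g x) (f x) < e / 2"
      by metis
    have "inj_on g A"
    proof (rule inj_onI)
      fix x y
      assume xy: "x \<in> A" "y \<in> A" "g x = g y"
      have "dist (g x) (f x) < e / 2"
        using g xy(1) by blast
      moreover have "dist (g x) (f y) < e / 2"
        unfolding xy(3) using g xy(2) by blast
      ultimately have "dist (f x) (f y) < e"
        using dist_triangle3[of "f x" "f y" "g x"] by linarith
      then show "x = y"
        using sep xy by blast
    qed
    then show "card A \<le> card C"
      using g C(1) by (auto intro: card_inj_on_le)
  qed
qed

lemma hypercube_normalized:
  assumes "0 < r" "x \<in> hypercube c r"
  shows "(1 / r) *\<^sub>R (x - c) \<in> cbox 0 (\<chi> i. 1)"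
proof -
  have "c $ i \<le> x $ i" "x $ i - c $ i \<le> r" for i
    using assms(2) by (auto simp: hypercube_def mem_box_cart algebra_simps)
  then have "0 \<le> (x $ i - c $ i) / r" "(x $ i - c $ i) / r \<le> 1" for i
    using assms(1) by simp_all
  then show ?thesis
    by (simp add: mem_box_cart)
qed

text \<open>Rescaling the cube to the unit cube makes one compact set serve for all \<open>c\<close>
  and \<open>r\<close>. An edge becomes the pair of its rescaled start and its direction, and the
  product metric bounds the distance in both components.\<close>

lemma nearly_parallel_family_bounded:
  "\<exists>N. \<forall>(E :: 'b set) a b (c :: real ^ 'd) r. 0 < r \<longrightarrow>
    (\<forall>e\<in>E. a e \<in> hypercube c r \<and> r / 4 \<le> dist (a e) (b e)) \<longrightarrow>
    (\<forall>e\<in>E. \<forall>e'\<in>E. two_opt_improves (a e) (b e) (a e') (b e') \<longrightarrow> e = e') \<longrightarrow> card E \<le> N"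
proof -
  have K: "compact (cbox 0 (\<chi> i. 1) \<times> sphere 0 1 :: ((real ^ 'd) \<times> (real ^ 'd)) set)"
    by (intro compact_Times compact_cbox compact_sphere)
  have "\<exists>N. \<forall>(A :: 'b set) f.
      f ` A \<subseteq> (cbox 0 (\<chi> i. 1) \<times> sphere 0 1 :: ((real ^ 'd) \<times> (real ^ 'd)) set) \<longrightarrow>
      (\<forall>x\<in>A. \<forall>y\<in>A. dist (f x) (f y) < 1 / 6 \<longrightarrow> x = y) \<longrightarrow> card A \<le> N"
    by (rule compact_separated_family_bounded[OF K]) simp
  then obtain N where N: "\<forall>(A :: 'b set) f.
      f ` A \<subseteq> (cbox 0 (\<chi> i. 1) \<times> sphere 0 1 :: ((real ^ 'd) \<times> (real ^ 'd)) set) \<longrightarrow>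
      (\<forall>x\<in>A. \<forall>y\<in>A. dist (f x) (f y) < 1 / 6 \<longrightarrow> x = y) \<longrightarrow> card A \<le> N" ..
  show ?thesis
  proof (intro exI allI impI)
    fix E :: "'b set" and a b :: "'b \<Rightarrow> real ^ 'd" and c r
    assume r: "0 < r"
      and E: "\<forall>e\<in>E. a e \<in> hypercube c r \<and> r / 4 \<le> dist (a e) (b e)"
      and eq: "\<forall>e\<in>E. \<forall>e'\<in>E. two_opt_improves (a e) (b e) (a e') (b e') \<longrightarrow> e = e'"
    define f where "f e = ((1 / r) *\<^sub>R (a e - c), sgn (b e - a e))" for e
    show "card E \<le> N"
    proof (rule N[rule_format, where f = f])
      show "f ` E \<subseteq> cbox 0 (\<chi> i. 1) \<times> sphere 0 1"
      proof
        fix z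
        assume "z \<in> f ` E"
        then obtain e where e: "e \<in> E" "z = f e"
          by blast
        \<comment> \<open>Needed because \<open>sgn 0 = 0\<close> is not on the unit sphere.\<close>
        then have "a e \<noteq> b e"
          using E r by force
        then show "z \<in> cbox 0 (\<chi> i. 1) \<times> sphere 0 1"
          using e hypercube_normalized[OF r, of "a e" c] bspec[OF E e(1)]
          by (simp add: f_def norm_sgn)
      qed
    next
      fix e e'
      assume e: "e \<in> E" "e' \<in> E" "dist (f e) (f e') < 1 / 6"
      have "dist ((1 / r) *\<^sub>R (a e - c)) ((1 / r) *\<^sub>R (a e' - c)) = dist (a e) (a e') / r"
        using r by (simp add: dist_norm flip: scaleR_diff_right)
      moreover have "dist (fst (f e)) (fst (f e')) < 1 / 6"
        using e(3) dist_fst_le[of "f e" "f e'"] by linarith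
      ultimately have "dist (a e) (a e') / r < 1 / 6"
        by (simp only: f_def fst_conv)
      then have "dist (a e) (a e') < r / 6"
        using r by (simp add: field_simps)
      moreover have "dist (snd (f e)) (snd (f e')) < 1 / 6"
        using e(3) dist_snd_le[of "f e" "f e'"] by linarith
      ultimately show "e = e'"
        using E eq e(1,2) two_opt_improves_if_nearly_parallel[of "a e" "a e'" r "b e" "b e'"]
        by (auto simp: f_def)
    qed
  qed
qed

section \<open>Packing for optimal tours\<close>

lemma optimal_tour_not_improvable:
  assumes rank: "rank_compatible n p D" and opt: "optimal_tour n D t"
    and e: "(i, j) \<in> set (tour_edges t)" "(k, l) \<in> set (tour_edges t)"
    and "two_opt_improves (p i) (p j) (p k) (p l)"
  shows "(i, j) = (k, l)"
proof (rule ccontr)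
  assume ne: "(i, j) \<noteq> (k, l)"
  have less: "dist (p w) (p x) < dist (p y) (p z) \<longleftrightarrow> D w x < D y z"
    if "w \<in> {1..n}" "x \<in> {1..n}" "y \<in> {1..n}" "z \<in> {1..n}" for w x y z
    using rank that by (simp add: rank_compatible_def)
  \<comment> \<open>\<open>D\<close> inherits symmetry from the distance: neither entry can be
    smaller than the other.\<close>
  have "D x y = D y x" if "x \<in> {1..n}" "y \<in> {1..n}" for x y
    using less[OF that that(2,1)] less[OF that(2,1) that] by (simp add: dist_commute)
  then have le: "D i j + D k l \<le> D i k + D j l"
    using ne by (intro optimal_tour_two_opt[OF opt _ e])
  have "t \<in> tours n"
    using opt by (simp add: optimal_tour_def)
  then have "i \<in> {1..n}" "j \<in> {1..n}" "k \<in> {1..n}" "l \<in> {1..n}"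
    using tour_edges_range e by blast+
  \<comment> \<open>Rank compatibility transfers each matched inequality to \<open>D\<close>; adding
    the two contradicts \<open>le\<close>.\<close>
  then have "D i k < D i j \<and> D j l < D k l \<or> D i k < D k l \<and> D j l < D i j"
    using assms(5) by (simp add: two_opt_improves_def less)
  with le show False
    by linarith
qed

theorem theorem8:
  assumes "CARD('d::finite) \<ge> 2"
  shows "\<exists>\<kappa>::nat. \<forall>n (p :: nat \<Rightarrow> real ^ 'd) (D :: nat \<Rightarrow> nat \<Rightarrow> real) t.
           inj_on p {1..n} \<longrightarrow> rank_compatible n p D \<longrightarrow> optimal_tour n D t \<longrightarrow>
           packing_property \<kappa> (tour_segments p t)"
proof -
  obtain N where N: "\<forall>(E :: (nat \<times> nat) set) a b (c :: real ^ 'd) r. 0 < r \<longrightarrow>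
    (\<forall>e\<in>E. a e \<in> hypercube c r \<and> r / 4 \<le> dist (a e) (b e)) \<longrightarrow>
    (\<forall>e\<in>E. \<forall>e'\<in>E. two_opt_improves (a e) (b e) (a e') (b e') \<longrightarrow> e = e') \<longrightarrow> card E \<le> N"
    using nearly_parallel_family_bounded ..
  have "packing_property (N + N) (tour_segments p t)"
    if rank: "rank_compatible n p D" and opt: "optimal_tour n D t"
    for n and p :: "nat \<Rightarrow> real ^ 'd" and D t
  proof -
    let ?T = "set (tour_edges t)" and ?seg = "\<lambda>(i, j). closed_segment (p i) (p j)"
    \<comment> \<open>One bound serves both halves of the property: it asks only for an endpoint in
      the cube and length at least \<open>r / 4\<close>.\<close>
    have bound: "finite S \<and> card S \<le> N + N"
      if r: "0 < r" and S: "S \<subseteq> {s \<in> tour_segments p t.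
        (\<exists>a b. s = closed_segment a b \<and> a \<in> hypercube c r) \<and> r / 4 \<le> segment_length s}"
      for S c r
    proof -
      \<comment> \<open>The 2-opt move joins starts to starts and ends to ends, so edges are split
        by which end lies in the cube. Each class has at most \<open>N\<close> members, whence
        \<open>N + N\<close>.\<close>
      define E1 where "E1 = {e \<in> ?T. p (fst e) \<in> hypercube c r \<and>
        r / 4 \<le> dist (p (fst e)) (p (snd e))}"
      define E2 where "E2 = {e \<in> ?T. p (snd e) \<in> hypercube c r \<and>
        r / 4 \<le> dist (p (snd e)) (p (fst e))}"
      have same: "e = e'" if "e \<in> ?T" "e' \<in> ?T"
        "two_opt_improves (p (fst e)) (p (snd e)) (p (fst e')) (p (snd e'))" for e e'
        using optimal_tour_not_improvable[OF rank opt, of "fst e" "snd e" "fst e'" "snd e'"] that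
        by simp
      have "card E1 \<le> N"
        by (rule N[rule_format, OF r, where a = "p \<circ> fst" and b = "p \<circ> snd" and c = c])
          (auto simp: E1_def dest: same)
      moreover have "card E2 \<le> N"
        by (rule N[rule_format, OF r, where a = "p \<circ> snd" and b = "p \<circ> fst" and c = c])
          (auto simp: E2_def two_opt_improves_swap dest: same)
      ultimately have "card (E1 \<union> E2) \<le> N + N"
        using card_Un_le[of E1 E2] by linarith
      moreover have fin: "finite (E1 \<union> E2)"
        by (simp add: E1_def E2_def)
      moreover have "S \<subseteq> ?seg ` (E1 \<union> E2)"
      proof
        fix s
        assume "s \<in> S"
        with S obtain a b where "s \<in> tour_segments p t" "s = closed_segment a b"
          "a \<in> hypercube c r" "r / 4 \<le> segment_length s"
          by blast
        moreover from this obtain i j where "(i, j) \<in> ?T" "s = closed_segment (p i) (p j)"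
          by (auto simp: tour_segments_def)
        \<comment> \<open>A segment determines its endpoints, so the endpoint in the cube is a tour
          vertex.\<close>
        moreover from calculation have "a = p i \<or> a = p j"
          by (auto simp: doubleton_eq_iff)
        ultimately have "(i, j) \<in> E1 \<union> E2" "s = ?seg (i, j)"
          by (auto simp: E1_def E2_def segment_length_closed_segment dist_commute)
        then show "s \<in> ?seg ` (E1 \<union> E2)"
          by blast
      qed
      ultimately show ?thesis
        by (meson card_image_le card_mono finite_imageI finite_subset le_trans)
    qed
    show ?thesis
      unfolding packing_property_def Let_def
    proof (intro allI impI)
      fix c :: "real ^ 'd" and r :: real
      assume r: "0 < r"
      let ?long = "{s \<in> tour_segments p t. crosses s (hypercube c r) \<and> r \<le> segment_length s}"
      let ?inner = "{s \<in> tour_segments p t. s \<subseteq> hypercube c r \<and> r / 4 \<le> segment_length s}"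
      have "finite ?long \<and> card ?long \<le> N + N"
        using r by (intro bound[OF r, of _ c]) (auto simp: crosses_def)
      moreover have "finite ?inner \<and> card ?inner \<le> N + N"
        using ends_in_segment(1) by (intro bound[OF r, of _ c]) (fastforce simp: tour_segments_def)
      ultimately show "finite ?long \<and> card ?long \<le> N + N \<and> finite ?inner \<and> card ?inner \<le> N + N"
        by blast
    qed
  qed
  then show ?thesis
    by blast
qed

end
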